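(* Let $(A,\cdot,[,],\alpha)$ be a Hom-Leibniz Poisson algebra, let $V$ be a vector space with a linear map $\phi:V\to V$, and let $\lambda^l,\lambda^r,\rho^l,\rho^r:A\to gl(V)$ be four linear maps. Then $(V,\lambda^l,\lambda^r,\rho^l,\rho^r,\phi)$ is a representation of $(A,\cdot,[,],\alpha)$ if and only if the direct sum of vector spaces $A\oplus V$, with the operations defined for $x,y\in A$, $u,v\in V$ by $$(x+u)\ast(y+v):=x\cdot y+(\lambda^l(x)v+\lambda^r(y)u),$$ $$\{x+u,y+v\}:=[x,y]+(\rho^l(x)v+\rho^r(y)u),$$ $$(\alpha\oplus\phi)(x+u):=\alpha(x)+\phi(u),$$ is a Hom-Leibniz Poisson algebra $(A\oplus V,\ast,\{,\},\alpha\oplus\phi)$.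
   Context: All vector spaces are over a field $\mathbb K$ of characteristic $0$; $gl(V)$ is the space of linear endomorphisms of $V$, and juxtaposition of operators is composition. A Hom-associative algebra $(A,\cdot,\alpha)$ is a vector space $A$ with a bilinear product and a linear map $\alpha:A\to A$ such that $\alpha(x\cdot y)=\alpha(x)\cdot\alpha(y)$ and $(x\cdot y)\cdot\alpha(z)=\alpha(x)\cdot(y\cdot z)$. A (right) Hom-Leibniz algebra $(A,[,],\alpha)$ is a vector space with a bilinear bracket and a linear map $\alpha$ such that $\alpha([x,y])=[\alpha(x),\alpha(y)]$ and $[[x,y],\alpha(z)]=[\alpha(x),[y,z]]+[[x,z],\alpha(y)]$. A Hom-Leibniz Poisson algebra $(A,\cdot,[,],\alpha)$ is such that $(A,\cdot,\alpha)$ is Hom-associative, $(A,[,],\alpha)$ is Hom-Leibniz, and $[x\cdot y,\alpha(z)]=\alpha(x)\cdot[y,z]+[x,z]\cdot\alpha(y)$ for all $x,y,z\in A$. A representation of a Hom-associative algebra $(A,\cdot,\alpha)$ is $(V,\lambda^l,\lambda^r,\phi)$ with $V$ a vector space, $\phi\in gl(V)$, and $\lambda^l,\lambda^r:A\to gl(V)$ linear such that for all $x,y\in A$: $\phi\lambda^l(x)=\lambda^l(\alpha(x))\phi$; $\phi\lambda^r(x)=\lambda^r(\alpha(x))\phi$; $\lambda^l(x\cdot y)\phi=\lambda^l(\alpha(x))\lambda^l(y)$; $\lambda^r(x\cdot y)\phi=\lambda^r(\alpha(y))\lambda^r(x)$; $\lambda^l(\alpha(x))\lambda^r(y)=\lambda^r(\alpha(y))\lambda^l(x)$.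 A representation of a Hom-Leibniz algebra $(A,[,],\alpha)$ is $(V,\rho^l,\rho^r,\phi)$ with $\phi\in gl(V)$ and $\rho^l,\rho^r:A\to gl(V)$ linear such that for all $x,y\in A$: $\rho^l(\alpha(x))\phi=\phi\rho^l(x)$; $\rho^r(\alpha(x))\phi=\phi\rho^r(x)$; $\rho^l([x,y])\phi=\rho^l(\alpha(x))\rho^l(y)+\rho^r(\alpha(y))\rho^l(x)$; $\rho^r(\alpha(y))\rho^l(x)=\rho^l(\alpha(x))\rho^r(y)+\rho^l([x,y])\phi$; $\rho^r(\alpha(y))\rho^r(x)=\rho^r([x,y])\phi+\rho^r(\alpha(x))\rho^r(y)$. A representation of a Hom-Leibniz Poisson algebra $(A,\cdot,[,],\alpha)$ is $(V,\lambda^l,\lambda^r,\rho^l,\rho^r,\phi)$ such that $(V,\lambda^l,\lambda^r,\phi)$ is a representation of $(A,\cdot,\alpha)$, $(V,\rho^l,\rho^r,\phi)$ is a representation of $(A,[,],\alpha)$, and for all $x,y\in A$: $\rho^r(\alpha(y))\lambda^l(x)=\lambda^l(\alpha(x))\rho^r(y)+\lambda^l([x,y])\phi$; $\rho^r(\alpha(y))\lambda^r(x)=\lambda^r([x,y])\phi+\lambda^r(\alpha(x))\rho^r(y)$; $\rho^l(x\cdot y)\phi=\lambda^l(\alpha(x))\rho^l(y)+\lambda^r(\alpha(y))\rho^l(x)$. *)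

theory Defs
  imports "HOL-Analysis.Product_Vector"
begin

definition bilinear_map ::
  "('k::field \<Rightarrow> 'a::ab_group_add \<Rightarrow> 'a) \<Rightarrow> ('k \<Rightarrow> 'b::ab_group_add \<Rightarrow> 'b) \<Rightarrow>
   ('k \<Rightarrow> 'c::ab_group_add \<Rightarrow> 'c) \<Rightarrow> ('a \<Rightarrow> 'b \<Rightarrow> 'c) \<Rightarrow> bool"
  where "bilinear_map s1 s2 s3 f \<longleftrightarrow>
    (\<forall>x. Vector_Spaces.linear s2 s3 (\<lambda>y. f x y)) \<and>
    (\<forall>y. Vector_Spaces.linear s1 s3 (\<lambda>x. f x y))"

definition gl :: "('k::field \<Rightarrow> 'v::ab_group_add \<Rightarrow> 'v) \<Rightarrow> ('v \<Rightarrow> 'v) set"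
  where "gl sV = {f. Vector_Spaces.linear sV sV f}"

(* The vector space operations of gl(V) are pointwise, so l : A -> gl(V) is linear
   iff every evaluation x |-> l x v is linear. *)
definition linear_to_gl ::
  "('k::field \<Rightarrow> 'a::ab_group_add \<Rightarrow> 'a) \<Rightarrow> ('k \<Rightarrow> 'v::ab_group_add \<Rightarrow> 'v) \<Rightarrow>
   ('a \<Rightarrow> 'v \<Rightarrow> 'v) \<Rightarrow> bool"
  where "linear_to_gl sA sV l \<longleftrightarrow>
    (\<forall>x. l x \<in> gl sV) \<and> (\<forall>v. Vector_Spaces.linear sA sV (\<lambda>x. l x v))"

locale hom_associative_algebra = vector_space sA
  for sA :: "'k::field_char_0 \<Rightarrow> 'a::ab_group_add \<Rightarrow> 'a" +
  fixes mul :: "'a \<Rightarrow> 'a \<Rightarrow> 'a"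
    and \<alpha> :: "'a \<Rightarrow> 'a"
  assumes mul_bilinear: "bilinear_map sA sA sA mul"
    and twist_linear: "Vector_Spaces.linear sA sA \<alpha>"
    and twist_mul: "\<alpha> (mul x y) = mul (\<alpha> x) (\<alpha> y)"
    and hom_assoc: "mul (mul x y) (\<alpha> z) = mul (\<alpha> x) (mul y z)"

(* Right Hom-Leibniz algebra. *)
locale hom_leibniz_algebra = vector_space sA
  for sA :: "'k::field_char_0 \<Rightarrow> 'a::ab_group_add \<Rightarrow> 'a" +
  fixes br :: "'a \<Rightarrow> 'a \<Rightarrow> 'a"
    and \<alpha> :: "'a \<Rightarrow> 'a"
  assumes br_bilinear: "bilinear_map sA sA sA br"
    and twist_linear: "Vector_Spaces.linear sA sA \<alpha>"
    and twist_br: "\<alpha> (br x y) = br (\<alpha> x) (\<alpha> y)"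
    and hom_leibniz: "br (br x y) (\<alpha> z) = br (\<alpha> x) (br y z) + br (br x z) (\<alpha> y)"

locale hom_leibniz_poisson_algebra =
  assoc: hom_associative_algebra sA mul \<alpha> + leibniz: hom_leibniz_algebra sA br \<alpha>
  for sA :: "'k::field_char_0 \<Rightarrow> 'a::ab_group_add \<Rightarrow> 'a"
    and mul :: "'a \<Rightarrow> 'a \<Rightarrow> 'a"
    and br :: "'a \<Rightarrow> 'a \<Rightarrow> 'a"
    and \<alpha> :: "'a \<Rightarrow> 'a" +
  assumes hom_poisson: "br (mul x y) (\<alpha> z) = mul (\<alpha> x) (br y z) + mul (br x z) (\<alpha> y)"

(* In the representation locales, identities between operators on V are written
   pointwise: each holds for all v in V. *)
locale hom_associative_representation =
  alg: hom_associative_algebra sA mul \<alpha> + vs: vector_space sV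
  for sA :: "'k::field_char_0 \<Rightarrow> 'a::ab_group_add \<Rightarrow> 'a"
    and mul :: "'a \<Rightarrow> 'a \<Rightarrow> 'a"
    and \<alpha> :: "'a \<Rightarrow> 'a"
    and sV :: "'k \<Rightarrow> 'v::ab_group_add \<Rightarrow> 'v" +
  fixes laml lamr :: "'a \<Rightarrow> 'v \<Rightarrow> 'v"
    and \<phi> :: "'v \<Rightarrow> 'v"
  assumes phi_gl: "\<phi> \<in> gl sV"
    and laml_linear: "linear_to_gl sA sV laml"
    and lamr_linear: "linear_to_gl sA sV lamr"
    and phi_laml: "\<phi> (laml x v) = laml (\<alpha> x) (\<phi> v)"
    and phi_lamr: "\<phi> (lamr x v) = lamr (\<alpha> x) (\<phi> v)"
    and laml_mul: "laml (mul x y) (\<phi> v) = laml (\<alpha> x) (laml y v)"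
    and lamr_mul: "lamr (mul x y) (\<phi> v) = lamr (\<alpha> y) (lamr x v)"
    and laml_lamr: "laml (\<alpha> x) (lamr y v) = lamr (\<alpha> y) (laml x v)"

locale hom_leibniz_representation =
  alg: hom_leibniz_algebra sA br \<alpha> + vs: vector_space sV
  for sA :: "'k::field_char_0 \<Rightarrow> 'a::ab_group_add \<Rightarrow> 'a"
    and br :: "'a \<Rightarrow> 'a \<Rightarrow> 'a"
    and \<alpha> :: "'a \<Rightarrow> 'a"
    and sV :: "'k \<Rightarrow> 'v::ab_group_add \<Rightarrow> 'v" +
  fixes rhol rhor :: "'a \<Rightarrow> 'v \<Rightarrow> 'v"
    and \<phi> :: "'v \<Rightarrow> 'v"
  assumes phi_gl: "\<phi> \<in> gl sV"
    and rhol_linear: "linear_to_gl sA sV rhol"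
    and rhor_linear: "linear_to_gl sA sV rhor"
    and rhol_phi: "rhol (\<alpha> x) (\<phi> v) = \<phi> (rhol x v)"
    and rhor_phi: "rhor (\<alpha> x) (\<phi> v) = \<phi> (rhor x v)"
    and rhol_br: "rhol (br x y) (\<phi> v) = rhol (\<alpha> x) (rhol y v) + rhor (\<alpha> y) (rhol x v)"
    and rhor_rhol: "rhor (\<alpha> y) (rhol x v) = rhol (\<alpha> x) (rhor y v) + rhol (br x y) (\<phi> v)"
    and rhor_rhor: "rhor (\<alpha> y) (rhor x v) = rhor (br x y) (\<phi> v) + rhor (\<alpha> x) (rhor y v)"

locale hom_leibniz_poisson_representation =
  alg: hom_leibniz_poisson_algebra sA mul br \<alpha> +
  assoc_rep: hom_associative_representation sA mul \<alpha> sV laml lamr \<phi> +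
  leibniz_rep: hom_leibniz_representation sA br \<alpha> sV rhol rhor \<phi>
  for sA :: "'k::field_char_0 \<Rightarrow> 'a::ab_group_add \<Rightarrow> 'a"
    and mul :: "'a \<Rightarrow> 'a \<Rightarrow> 'a"
    and br :: "'a \<Rightarrow> 'a \<Rightarrow> 'a"
    and \<alpha> :: "'a \<Rightarrow> 'a"
    and sV :: "'k \<Rightarrow> 'v::ab_group_add \<Rightarrow> 'v"
    and laml lamr rhol rhor :: "'a \<Rightarrow> 'v \<Rightarrow> 'v"
    and \<phi> :: "'v \<Rightarrow> 'v" +
  assumes rhor_laml: "rhor (\<alpha> y) (laml x v) = laml (\<alpha> x) (rhor y v) + laml (br x y) (\<phi> v)"
    and rhor_lamr: "rhor (\<alpha> y) (lamr x v) = lamr (br x y) (\<phi> v) + lamr (\<alpha> x) (rhor y v)"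
    and rhol_mul: "rhol (mul x y) (\<phi> v) = laml (\<alpha> x) (rhol y v) + lamr (\<alpha> y) (rhol x v)"

end

theory Submission
  imports Defs
begin

text \<open>Expand each algebra identity on \<open>A \<oplus> V\<close> at \<open>(x, u)\<close>, \<open>(y, v)\<close>, \<open>(z, w)\<close>.
  Its \<open>A\<close>-component is the identity of \<open>A\<close>. Its \<open>V\<close>-component is additive in
  \<open>u\<close>, \<open>v\<close>, \<open>w\<close>, so it splits, on setting two of the three vectors to \<open>0\<close>, into
  three operator identities, and these are the representation axioms.\<close>

text \<open>One formula serves both operations on A \<oplus> V: the product with
  \<open>laml\<close>, \<open>lamr\<close> and the bracket with \<open>rhol\<close>,
  \<open>rhor\<close>. Being an abbreviation, it is the very lambda term of the theorem, so facts
  about it apply without unfolding.\<close>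

abbreviation semidirect_prod ::
  "('a \<Rightarrow> 'a \<Rightarrow> 'a) \<Rightarrow> ('a \<Rightarrow> 'v \<Rightarrow> 'v::ab_group_add) \<Rightarrow> ('a \<Rightarrow> 'v \<Rightarrow> 'v) \<Rightarrow>
   'a \<times> 'v \<Rightarrow> 'a \<times> 'v \<Rightarrow> 'a \<times> 'v"
  where "semidirect_prod m l r \<equiv> \<lambda>(x, u) (y, v). (m x y, l x v + r y u)"

lemma linear_to_gl_simps:
  assumes "linear_to_gl sA sV l"
  shows "l (x + y) v = l x v + l y v" "l x (u + v) = l x u + l x v"
    "l (sA c x) v = sV c (l x v)" "l x (sV c v) = sV c (l x v)" "l 0 v = 0" "l x 0 = 0"
proof -
  have 1: "Vector_Spaces.linear sV sV (l x)" for x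
    using assms by (auto simp: linear_to_gl_def gl_def)
  have 2: "Vector_Spaces.linear sA sV (\<lambda>x. l x v)" for v
    using assms by (auto simp: linear_to_gl_def)
  note r1 = 1[unfolded linear_iff_module_hom] and r2 = 2[unfolded linear_iff_module_hom]
  show "l (x + y) v = l x v + l y v" "l (sA c x) v = sV c (l x v)" "l 0 v = 0"
    using module_hom.add[OF r2] module_hom.scale[OF r2] module_hom.zero[OF r2] by auto
  show "l x (u + v) = l x u + l x v" "l x (sV c v) = sV c (l x v)" "l x 0 = 0"
    using module_hom.add[OF r1] module_hom.scale[OF r1] module_hom.zero[OF r1] by auto
qed

lemma bilinear_map_simps:
  assumes "bilinear_map s s s m"
  shows "m (x + y) z = m x z + m y z" "m x (y + z) = m x y + m x z"
    "m (s c x) y = s c (m x y)" "m x (s c y) = s c (m x y)"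
proof -
  have 1: "Vector_Spaces.linear s s (m x)" and 2: "Vector_Spaces.linear s s (\<lambda>x. m x y)" for x y
    using assms by (auto simp: bilinear_map_def)
  show "m (x + y) z = m x z + m y z" "m (s c x) y = s c (m x y)"
    using 2 by (auto simp: Vector_Spaces.linear_iff)
  show "m x (y + z) = m x y + m x z" "m x (s c y) = s c (m x y)"
    using 1 by (auto simp: Vector_Spaces.linear_iff)
qed

lemma scale_Pair:
  assumes "vector_space sA" "vector_space sV"
  shows "module_prod.scale sA sV c (x, v) = (sA c x, sV c v)"
proof -
  interpret vector_space_prod sA sV
    using assms by (simp add: vector_space_prod_def vector_space_pair_def)
  show ?thesis by (rule scale_prod)
qed

lemma vector_space_scale:
  assumes "vector_space sA" "vector_space sV"
  shows "vector_space (module_prod.scale sA sV)"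
proof -
  interpret vector_space_prod sA sV
    using assms by (simp add: vector_space_prod_def vector_space_pair_def)
  show ?thesis by (rule p.vector_space_axioms)
qed

text \<open>With (y, v) fixed, \<open>l x v\<close> is linear through its algebra argument and
  \<open>r y u\<close> through its vector argument; with (x, u) fixed the roles swap. Thus both
  conditions in \<open>linear_to_gl\<close> enter, for \<open>l\<close> and for
  \<open>r\<close>.\<close>

lemma bilinear_map_semidirect_prod:
  assumes A: "vector_space sA" and V: "vector_space sV" and m: "bilinear_map sA sA sA m"
    and l: "linear_to_gl sA sV l" and r: "linear_to_gl sA sV r"
  shows "bilinear_map (module_prod.scale sA sV) (module_prod.scale sA sV)
    (module_prod.scale sA sV) (semidirect_prod m l r)"
  unfolding bilinear_map_def Vector_Spaces.linear_iff
  using V by (auto simp: vector_space_scale[OF A V] scale_Pair[OF A V] bilinear_map_simps[OF m]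
      linear_to_gl_simps[OF l] linear_to_gl_simps[OF r]
      vector_space.vector_space_assms(1) algebra_simps)

lemma linear_direct_sum:
  assumes f: "Vector_Spaces.linear sA sA f" and g: "Vector_Spaces.linear sV sV g"
  shows "Vector_Spaces.linear (module_prod.scale sA sV) (module_prod.scale sA sV)
    (\<lambda>(x, u). (f x, g u))"
proof -
  have A: "vector_space sA" and V: "vector_space sV"
    using f g by (auto simp: Vector_Spaces.linear_iff)
  show ?thesis
    using f g unfolding Vector_Spaces.linear_iff by (auto simp: vector_space_scale[OF A V] scale_Pair[OF A V])
qed

text \<open>In the V-component of Hom-associativity, the terms in u, v, w give
  \<open>lamr_mul\<close>, \<open>laml_lamr\<close>, \<open>laml_mul\<close> respectively.
  Multiplicativity of the twist splits into \<open>phi_lamr\<close> (from u) and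
  \<open>phi_laml\<close> (from v).\<close>

lemma hom_associative_representation_iff_semidirect:
  assumes alg: "hom_associative_algebra sA mul \<alpha>" and V: "vector_space sV"
    and \<phi>: "Vector_Spaces.linear sV sV \<phi>"
    and l: "linear_to_gl sA sV laml" and r: "linear_to_gl sA sV lamr"
  shows "hom_associative_representation sA mul \<alpha> sV laml lamr \<phi> \<longleftrightarrow>
    hom_associative_algebra (module_prod.scale sA sV)
      (semidirect_prod mul laml lamr) (\<lambda>(x, u). (\<alpha> x, \<phi> u))"
    (is "?rep \<longleftrightarrow> ?alg")
proof -
  interpret A: hom_associative_algebra sA mul \<alpha> by (fact alg)
  interpret \<phi>: Vector_Spaces.linear sV sV \<phi> by (fact \<phi>)
  note simps = linear_to_gl_simps[OF l] linear_to_gl_simps[OF r]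
  show ?thesis
  proof
    assume ?rep
    then interpret R: hom_associative_representation sA mul \<alpha> sV laml lamr \<phi> .
    show ?alg
      unfolding hom_associative_algebra_def hom_associative_algebra_axioms_def
      by (auto simp: vector_space_scale[OF A.vector_space_axioms V]
          bilinear_map_semidirect_prod[OF A.vector_space_axioms V A.mul_bilinear l r]
          linear_direct_sum[OF A.twist_linear \<phi>] simps \<phi>.add A.twist_mul A.hom_assoc
          R.phi_laml R.phi_lamr R.laml_mul R.lamr_mul R.laml_lamr)
  next
    assume ?alg
    then interpret S: hom_associative_algebra "module_prod.scale sA sV"
      "semidirect_prod mul laml lamr" "\<lambda>(x, u). (\<alpha> x, \<phi> u)" .
    have twist: "\<phi> (laml x v + lamr y u) = laml (\<alpha> x) (\<phi> v) + lamr (\<alpha> y) (\<phi> u)" for x y u v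
      using S.twist_mul[of "(x, u)" "(y, v)"] by simp
    have assoc: "laml (mul x y) (\<phi> w) + lamr (\<alpha> z) (laml x v + lamr y u) =
        laml (\<alpha> x) (laml y w + lamr z v) + lamr (mul y z) (\<phi> u)" for x y z u v w
      using S.hom_assoc[of "(x, u)" "(y, v)" "(z, w)"] by simp
    show ?rep
    proof (unfold_locales)
      fix x y v
      \<comment> \<open>Instantiation follows the order of first occurrence in the equation: x, v,
        y, u in \<open>twist\<close>, and x, y, w, z, v, u in \<open>assoc\<close> below. The
        algebra element that does not occur in the target axiom is also set to 0.\<close>
      show "\<phi> (laml x v) = laml (\<alpha> x) (\<phi> v)" using twist[of x v 0 0] by (simp add: simps)
      show "\<phi> (lamr x v) = lamr (\<alpha> x) (\<phi> v)" using twist[of 0 0 x v] by (simp add: simps)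
      show "laml (mul x y) (\<phi> v) = laml (\<alpha> x) (laml y v)"
        using assoc[of x y v 0 0 0] by (simp add: simps)
      show "lamr (mul x y) (\<phi> v) = lamr (\<alpha> y) (lamr x v)"
        using assoc[of 0 x 0 y 0 v] by (simp add: simps)
      show "laml (\<alpha> x) (lamr y v) = lamr (\<alpha> y) (laml x v)"
        using assoc[of x 0 0 y v 0] by (simp add: simps)
    qed (use V \<phi> l r in \<open>auto simp: gl_def vector_space.vector_space_assms\<close>)
  qed
qed

text \<open>Here the terms in u, v, w of the Hom-Leibniz identity give \<open>rhor_rhor\<close>,
  \<open>rhor_rhol\<close>, \<open>rhol_br\<close> respectively.\<close>

lemma hom_leibniz_representation_iff_semidirect:
  assumes alg: "hom_leibniz_algebra sA br \<alpha>" and V: "vector_space sV"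
    and \<phi>: "Vector_Spaces.linear sV sV \<phi>"
    and l: "linear_to_gl sA sV rhol" and r: "linear_to_gl sA sV rhor"
  shows "hom_leibniz_representation sA br \<alpha> sV rhol rhor \<phi> \<longleftrightarrow>
    hom_leibniz_algebra (module_prod.scale sA sV)
      (semidirect_prod br rhol rhor) (\<lambda>(x, u). (\<alpha> x, \<phi> u))"
    (is "?rep \<longleftrightarrow> ?alg")
proof -
  interpret A: hom_leibniz_algebra sA br \<alpha> by (fact alg)
  interpret \<phi>: Vector_Spaces.linear sV sV \<phi> by (fact \<phi>)
  note simps = linear_to_gl_simps[OF l] linear_to_gl_simps[OF r]
  show ?thesis
  proof
    assume ?rep
    then interpret R: hom_leibniz_representation sA br \<alpha> sV rhol rhor \<phi> .
    \<comment> \<open>The axioms would loop as rewrite rules: \<open>rhor_rhor\<close> reproduces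
      its left-hand side with x and y swapped, and \<open>rhol_br\<close> and
      \<open>rhor_rhol\<close> feed each other. So one fixed instance of each, for w, v and u, is
      added up by hand. For the same reason \<open>A.hom_leibniz\<close> is used below as an
      introduction rule.\<close>
    have leibniz: "rhol (br x y) (\<phi> w) + rhor (\<alpha> z) (rhol x v + rhor y u) =
        rhol (\<alpha> x) (rhol y w + rhor z v) + rhor (br y z) (\<phi> u) +
        (rhol (br x z) (\<phi> v) + rhor (\<alpha> y) (rhol x w + rhor z u))" for x y z u v w
      using R.rhol_br[of x y w] R.rhor_rhol[of z x v] R.rhor_rhor[of z y u]
      by (simp add: simps)
    show ?alg
      unfolding hom_leibniz_algebra_def hom_leibniz_algebra_axioms_def
      by (auto simp: vector_space_scale[OF A.vector_space_axioms V]
          bilinear_map_semidirect_prod[OF A.vector_space_axioms V A.br_bilinear l r]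
          linear_direct_sum[OF A.twist_linear \<phi>] \<phi>.add A.twist_br
          R.rhol_phi R.rhor_phi intro: A.hom_leibniz leibniz)
  next
    assume ?alg
    then interpret S: hom_leibniz_algebra "module_prod.scale sA sV"
      "semidirect_prod br rhol rhor" "\<lambda>(x, u). (\<alpha> x, \<phi> u)" .
    have twist: "\<phi> (rhol x v + rhor y u) = rhol (\<alpha> x) (\<phi> v) + rhor (\<alpha> y) (\<phi> u)" for x y u v
      using S.twist_br[of "(x, u)" "(y, v)"] by simp
    have leibniz: "rhol (br x y) (\<phi> w) + rhor (\<alpha> z) (rhol x v + rhor y u) =
        rhol (\<alpha> x) (rhol y w + rhor z v) + rhor (br y z) (\<phi> u) +
        (rhol (br x z) (\<phi> v) + rhor (\<alpha> y) (rhol x w + rhor z u))" for x y z u v w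
      using S.hom_leibniz[of "(x, u)" "(y, v)" "(z, w)"] by simp
    show ?rep
    proof (unfold_locales)
      fix x y v
      show "rhol (\<alpha> x) (\<phi> v) = \<phi> (rhol x v)" using twist[of x v 0 0] by (simp add: simps)
      show "rhor (\<alpha> x) (\<phi> v) = \<phi> (rhor x v)" using twist[of 0 0 x v] by (simp add: simps)
      show "rhol (br x y) (\<phi> v) = rhol (\<alpha> x) (rhol y v) + rhor (\<alpha> y) (rhol x v)"
        using leibniz[of x y v 0 0 0] by (simp add: simps)
      show "rhor (\<alpha> y) (rhol x v) = rhol (\<alpha> x) (rhor y v) + rhol (br x y) (\<phi> v)"
        using leibniz[of x 0 0 y v 0] by (simp add: simps)
      show "rhor (\<alpha> y) (rhor x v) = rhor (br x y) (\<phi> v) + rhor (\<alpha> x) (rhor y v)"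
        using leibniz[of 0 x 0 y 0 v] by (simp add: simps)
    qed (use V \<phi> l r in \<open>auto simp: gl_def vector_space.vector_space_assms\<close>)
  qed
qed

theorem proposition4p6:
  fixes sA :: "'k::field_char_0 \<Rightarrow> 'a::ab_group_add \<Rightarrow> 'a"
    and mul br :: "'a \<Rightarrow> 'a \<Rightarrow> 'a"
    and \<alpha> :: "'a \<Rightarrow> 'a"
    and sV :: "'k \<Rightarrow> 'v::ab_group_add \<Rightarrow> 'v"
    and \<phi> :: "'v \<Rightarrow> 'v"
    and laml lamr rhol rhor :: "'a \<Rightarrow> 'v \<Rightarrow> 'v"
  assumes "hom_leibniz_poisson_algebra sA mul br \<alpha>"
    and "vector_space sV"
    and "Vector_Spaces.linear sV sV \<phi>"
    and "linear_to_gl sA sV laml"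
    and "linear_to_gl sA sV lamr"
    and "linear_to_gl sA sV rhol"
    and "linear_to_gl sA sV rhor"
  shows "hom_leibniz_poisson_representation sA mul br \<alpha> sV laml lamr rhol rhor \<phi> \<longleftrightarrow>
    hom_leibniz_poisson_algebra (module_prod.scale sA sV)
      (\<lambda>(x, u) (y, v). (mul x y, laml x v + lamr y u))
      (\<lambda>(x, u) (y, v). (br x y, rhol x v + rhor y u))
      (\<lambda>(x, u). (\<alpha> x, \<phi> u))"
    (is "?rep \<longleftrightarrow> ?alg")
proof -
  interpret A: hom_leibniz_poisson_algebra sA mul br \<alpha> by (fact assms(1))
  interpret \<phi>: Vector_Spaces.linear sV sV \<phi> by (fact assms(3))
  note simps = assms(4-7)[THEN linear_to_gl_simps(2)] assms(4-7)[THEN linear_to_gl_simps(5)]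
    assms(4-7)[THEN linear_to_gl_simps(6)]
  \<comment> \<open>These two equivalences settle everything except the compatibility of product and
    bracket: what remains is to match \<open>hom_poisson\<close> on A \<oplus> V with the three
    mixed axioms.\<close>
  note assoc_iff = hom_associative_representation_iff_semidirect
    [OF A.assoc.hom_associative_algebra_axioms assms(2-5)]
  note leibniz_iff = hom_leibniz_representation_iff_semidirect
    [OF A.leibniz.hom_leibniz_algebra_axioms assms(2,3,6,7)]
  show ?thesis
  proof
    assume ?rep
    then interpret R: hom_leibniz_poisson_representation sA mul br \<alpha> sV laml lamr rhol rhor \<phi> .
    have poisson: "rhol (mul x y) (\<phi> w) + rhor (\<alpha> z) (laml x v + lamr y u) =
        laml (\<alpha> x) (rhol y w + rhor z v) + lamr (br y z) (\<phi> u) +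
        (laml (br x z) (\<phi> v) + lamr (\<alpha> y) (rhol x w + rhor z u))" for x y z u v w
      using R.rhol_mul[of x y w] R.rhor_laml[of z x v] R.rhor_lamr[of z y u]
      by (simp add: simps)
    show ?alg
      \<comment> \<open>Read from right to left, the equivalences turn the Hom-associative and
        Hom-Leibniz conditions on A \<oplus> V back into representation claims, which
        \<open>R\<close> supplies.\<close>
      unfolding hom_leibniz_poisson_algebra_def hom_leibniz_poisson_algebra_axioms_def
        assoc_iff[symmetric] leibniz_iff[symmetric]
      using R.assoc_rep.hom_associative_representation_axioms
        R.leibniz_rep.hom_leibniz_representation_axioms
      by (auto simp: A.hom_poisson poisson)
  next
    assume ?alg
    then interpret S: hom_leibniz_poisson_algebra "module_prod.scale sA sV"
      "semidirect_prod mul laml lamr" "semidirect_prod br rhol rhor" "\<lambda>(x, u). (\<alpha> x, \<phi> u)" .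
    have poisson: "rhol (mul x y) (\<phi> w) + rhor (\<alpha> z) (laml x v + lamr y u) =
        laml (\<alpha> x) (rhol y w + rhor z v) + lamr (br y z) (\<phi> u) +
        (laml (br x z) (\<phi> v) + lamr (\<alpha> y) (rhol x w + rhor z u))" for x y z u v w
      using S.hom_poisson[of "(x, u)" "(y, v)" "(z, w)"] by simp
    \<comment> \<open>Once both representations are in context, \<open>unfold_locales\<close> leaves
      only the mixed axioms. The v, u and w terms of \<open>poisson\<close> give them in the order
      shown.\<close>
    interpret hom_associative_representation sA mul \<alpha> sV laml lamr \<phi>
      using S.assoc.hom_associative_algebra_axioms by (simp only: assoc_iff)
    interpret hom_leibniz_representation sA br \<alpha> sV rhol rhor \<phi>
      using S.leibniz.hom_leibniz_algebra_axioms by (simp only: leibniz_iff)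
    show ?rep
    proof (unfold_locales)
      fix x y v
      show "rhor (\<alpha> y) (laml x v) = laml (\<alpha> x) (rhor y v) + laml (br x y) (\<phi> v)"
        using poisson[of x 0 0 y v 0] by (simp add: simps)
      show "rhor (\<alpha> y) (lamr x v) = lamr (br x y) (\<phi> v) + lamr (\<alpha> x) (rhor y v)"
        using poisson[of 0 x 0 y 0 v] by (simp add: simps)
      show "rhol (mul x y) (\<phi> v) = laml (\<alpha> x) (rhol y v) + lamr (\<alpha> y) (rhol x v)"
        using poisson[of x y v 0 0 0] by (simp add: simps)
    qed
  qed
qed

end
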